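(* Fix $n\in\mathbb N_0$ and a compact set $\mathcal K^{(3)}\Subset\{(M,a,\Lambda):\Lambda>0,\ (M,a)\in\mathcal P_\Lambda,\ 0<a_1\le|a|\le a_0\}$ (slow rotation, $a_1>0$). Choose $\ell$ large so that the two-mode decomposition (A1), the frequency-error estimate (A3) and the three-parameter inverse stability (A4') of the context hold on $\mathcal K^{(3)}$, and let $\mu=(M,a,\Lambda)\in\mathcal K^{(3)}$ be the true parameters. Fix an observation window $[T_0,T_0+T]$ with $T_0\ge1$, a shift $\Delta\in(0,T)$ and a weight $w$ as in the context. Assume the detectability condition $a_{+,\ell}\ne0$, $a_{-,\ell}\neq0$, and let $\varepsilon_\pm$ be the relative residual sizes of the context. If $\varepsilon_\pm\le\min\{1/8,|z_\pm|/20\}$ with $z_\pm=e^{-i\omega_{\pm,\ell}\Delta}$, then the reconstructed parameters $\widehat\mu=(\widehat M,\widehat a,\widehat\Lambda)$ defined by inverting $\widehat{\mathcal H}_\ell$ satisfy $$|\widehat\mu-\mu|\le\frac{5\sqrt2\,C_*^{(3)}}{\Delta\,\ell}\left(\frac{\varepsilon_+}{|z_+|}+\frac{\varepsilon_-}{|z_-|}\right)+\frac{10\,C_*^{(3)}}{\Delta\,(n+\frac12)}\,\frac{\varepsilon_+}{|z_+|}.$$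
   Context: **Setting.** $\mathcal P_\Lambda$ is the set of subextremal Kerr–de Sitter parameters $(M,a)$ (for which $(r^2+a^2)(1-\Lambda r^2/3)-2Mr$ has at least two distinct positive simple roots $0<r_e<r_c$, corresponding to the event and cosmological horizons). $P=\Box_g+V$ ($V$ smooth, stationary, axisymmetric) is the scalar wave operator on Kerr–de Sitter with parameters $(M,a,\Lambda)$ in future-horizon-regular coordinates $(t_*,r,\theta,\varphi_* )$, with spatial slice $X=[r_e-\delta,r_c+\delta]\times\mathbb S^2$ and physical part $X^{\mathrm{phys}}=(r_e,r_c)\times\mathbb S^2$; normalized so that $P=\partial_{t_*}^2+Q\partial_{t_*}+L$. $P(\omega)=L-i\omega Q-\omega^2$, and $R(\omega)=P(\omega)^{-1}$ is its meromorphically continued outgoing inverse, whose poles are the quasinormal modes (QNMs). $\mathcal H^s=H^{s+1}(X)\times H^s(X)$. For $0\le j\le n+1$, $\omega^\sharp_{j,\pm,\ell}$ are the equatorial pseudopoles (approximate QNMs) in the azimuthal sector $k=\pm\ell$, with nearby simple QNMs $\omega_{j,\pm,\ell}$, $|\omega_{j,\pm,\ell}-\omega^\sharp_{j,\pm,\ell}|=\mathcal O(\ell^{-\infty})$ uniformly; $\omega_{\pm,\ell}:=\omega_{n,\pm,\ell}(M,a,\Lambda)$, $\omega^\sharp_{\pm,\ell}:=\omega^\sharp_{n,\pm,\ell}$; $\Im\omega_{\pm,\ell}\le 0$. **Refined signals.** Let $u$ solve $Pu=0$ with data $(f_0,f_1)$ at $t_*=0$ supported in a fixed compact $K_0\Subset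 X^{\mathrm{phys}}$. $\vartheta\in C^\infty(\mathbb R)$ equals $0$ for $t_*\le0$ and $1$ for $t_*\ge1$; $F_\vartheta=P(\vartheta u)$, $\widehat F_\vartheta(\omega)=\int_0^1e^{i\omega t_*}F_\vartheta\,dt_*$; $\chi\in C_c^\infty(X^{\mathrm{phys}})$ equals $1$ near the spatial support of $F_\vartheta$ for all such data. $\Pi_k$ projects onto $\partial_{\varphi_*}v=ikv$; $A_{\pm,h}=I_r\otimes\mathrm{Op}_h(a_\pm)$ with order-$0$ symbols on $T^*\mathbb S^2$, independent of $\varphi_*$, supported near and equal to $1$ in a smaller neighborhood of $\{\theta=\pi/2,\eta_\theta=0,\eta_\varphi=\pm1\}$, $a_+a_-=0$. $\widetilde g_{\pm,\ell}(\omega)=(\omega/\omega^\sharp_{\pm,\ell})^{n+2}\prod_{j=0}^{n-1}\frac{\omega-\omega^\sharp_{j,\pm,\ell}}{\omega^\sharp_{\pm,\ell}-\omega^\sharp_{j,\pm,\ell}}$. For $C$ large, $u^{(\pm,\ell)}(t)=\chi A_{\pm,1/\ell}\Pi_{\pm\ell}\frac1{2\pi}\int_{\Im\omega=C}e^{-i\omega t}\widetilde g_{\pm,\ell}(\omega)R(\omega)\widehat F_\vartheta(\omega)\,d\omega$. **(A1) Two-mode decomposition.** For $t\ge1$, $u^{(\pm,\ell)}(t)=e^{-i\omega_{\pm,\ell}t}A_{\pm,\ell}+E_{\pm,\ell}(t)$ with $A_{\pm,\ell}\in H^{s+1}(X)$ depending linearly on the data, and for all $m,N'$, $\|E_{\pm,\ell}(t)\|_{H^{s+1}}\le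 C_{s,m,N'}(e^{-\nu t}(1+t)^{-m}+\ell^{-N'})\|(f_0,f_1)\|_{\mathcal H^{s+m+N_{m,N'}}}$, uniformly on $\mathcal K^{(3)}$ and for large $\ell$, where $\nu>0$ is the height of a uniformly pole-separated line $\Im\omega=-\nu$ between the $n$th and $(n+1)$st equatorial overtone layers. **Observation.** $\mathsf O:H^{s+1}(X)\to\mathbb C$ is a bounded linear functional; $a_{\pm,\ell}=\mathsf O(A_{\pm,\ell})$, $\rho_{\pm,\ell}(t)=\mathsf O(E_{\pm,\ell}(t))$, $y_{0,\pm}(t)=a_{\pm,\ell}e^{-i\omega_{\pm,\ell}t}$. The measured signals on $[T_0,T_0+T]$ are $\widetilde y_\pm=\mathsf O(u^{(\pm,\ell)})+\eta_\pm=y_{0,\pm}+r_\pm$, $r_\pm=\rho_{\pm,\ell}+\eta_\pm$, with $\eta_\pm$ a deterministic measurement perturbation. The weight $w\in L^\infty([T_0,T_0+T-\Delta])$ satisfies $0\le w\le1$ and $w\equiv1$ on $[T_0+\Delta,T_0+T-2\Delta]$; $\langle f,g\rangle_w=\int_{T_0}^{T_0+T-\Delta}wf\bar g\,dt$, $\|f\|_w^2=\langle f,f\rangle_w$, $(S_\Delta f)(t)=f(t+\Delta)$. $\varepsilon_\pm=\max\{\|r_\pm\|_w,\|S_\Delta r_\pm\|_w\}/\|y_{0,\pm}\|_w$. **(A3) Frequency estimators and frequency-error estimate.** $\widehat z_\pm=\langle S_\Delta\widetilde y_\pm,\widetilde y_\pm\rangle_w/\langle\widetilde y_\pm,\widetilde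 y_\pm\rangle_w$, $\widehat\omega_\pm=\frac i\Delta\operatorname{Log}(\widehat z_\pm)$, where the logarithm branch is chosen consistently with the prior $\omega^\sharp_{\pm,\ell}$: $\operatorname{Log}(\zeta)=\operatorname{Log}_{\mathrm{principal}}(\zeta/z^\sharp_\pm)-i\omega^\sharp_{\pm,\ell}\Delta$, $z^\sharp_\pm=e^{-i\omega^\sharp_{\pm,\ell}\Delta}$ (branch selection in the regime $|z_\pm-z_\pm^\sharp|\le\frac14|z^\sharp_\pm|$, $|\widehat z_\pm-z_\pm|\le\frac12|z_\pm|$). The estimate (A3) states: if $a_{\pm,\ell}\ne0$, $\Im\omega_{\pm,\ell}\le0$ and $\varepsilon_\pm\le\min\{1/8,|z_\pm|/20\}$, then $|\widehat\omega_\pm-\omega_{\pm,\ell}|\le\frac{10}{\Delta|z_\pm|}\varepsilon_\pm$. **(A4') Three-parameter inverse map (companion-paper input).** $U_\ell=\Re\frac{\omega_{+,\ell}+\omega_{-,\ell}}{2\ell}$, $V_\ell=\Re\frac{\omega_{+,\ell}-\omega_{-,\ell}}{2\ell}$, $\widetilde W_\ell=-\frac{\Im\omega_{+,\ell}}{n+1/2}$, and $\mathcal H_\ell=(U_\ell,V_\ell,\widetilde W_\ell):\mathcal K^{(3)}\to\mathbb R^3$ is real-analytic. Each $\mu\in\mathcal K^{(3)}$ has a neighborhood $\mathcal N\subset\mathcal K^{(3)}$ on which $\mathcal H_\ell$ is injective and $|\mu_1-\mu_2|\le C_*^{(3)}|\mathcal H_\ell(\mu_1)-\mathcal H_\ell(\mu_2)|$,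 with $C_*^{(3)}>0$ independent of $\ell$ and $\mu$. The estimated data are $\widehat{\mathcal H}_\ell=\big(\Re\frac{\widehat\omega_++\widehat\omega_-}{2\ell},\Re\frac{\widehat\omega_+-\widehat\omega_-}{2\ell},-\frac{\Im\widehat\omega_+}{n+1/2}\big)$, and $\widehat\mu$ is obtained by applying to $\widehat{\mathcal H}_\ell$ the local inverse of $\mathcal H_\ell$ near the true $\mu$. *)

theory Defs
  imports "HOL-Complex_Analysis.Complex_Analysis"
begin

section \<open>Smooth functions\<close>

primrec Ck_on :: "nat \<Rightarrow> 'a::euclidean_space set \<Rightarrow> ('a \<Rightarrow> 'b::real_normed_vector) \<Rightarrow> bool" where
  "Ck_on 0 U f = continuous_on U f"
| "Ck_on (Suc k) U f =
     (f differentiable_on U \<and> (\<forall>b\<in>Basis. Ck_on k U (\<lambda>x. frechet_derivative f (at x) b)))"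

text \<open>Only meant for open \<open>U\<close>; \<open>smooth_upto\<close> is smoothness up to the boundary of a closed set.\<close>

definition smooth_on :: "'a::euclidean_space set \<Rightarrow> ('a \<Rightarrow> 'b::real_normed_vector) \<Rightarrow> bool" where
  "smooth_on U f \<longleftrightarrow> (\<forall>k. Ck_on k U f)"

definition smooth_upto :: "'a::euclidean_space set \<Rightarrow> ('a \<Rightarrow> 'b::real_normed_vector) \<Rightarrow> bool" where
  "smooth_upto X f \<longleftrightarrow> (\<exists>U g. open U \<and> X \<subseteq> U \<and> smooth_on U g \<and> (\<forall>x\<in>X. g x = f x))"

definition supp :: "('a::topological_space \<Rightarrow> 'b::zero) \<Rightarrow> 'a set" where
  "supp f = closure {x. f x \<noteq> 0}"


section \<open>Sobolev spaces\<close>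

text \<open>
  \<open>[r1, r2] \<times> S\<^sup>2\<close> with \<open>r1 > 0\<close> is identified, by polar coordinates, with a closed spherical
  shell in \<open>\<real>\<^sup>3\<close>; triples carry the Euclidean norm, inner product and Lebesgue measure.
\<close>

type_synonym pt = "real \<times> real \<times> real"
type_synonym field = "pt \<Rightarrow> complex"

definition fourier3 :: "field \<Rightarrow> field" where
  "fourier3 f \<xi> = (LINT x|lborel. exp (- \<i> * of_real (x \<bullet> \<xi>)) * f x)"

definition hs_energy :: "real \<Rightarrow> field \<Rightarrow> ennreal" where
  "hs_energy s f =
     (\<integral>\<^sup>+\<xi>. ennreal ((1 + (norm \<xi>)\<^sup>2) powr s * (cmod (fourier3 f \<xi>))\<^sup>2) \<partial>lborel)"

definition extensions :: "pt set \<Rightarrow> field \<Rightarrow> field set" where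
  "extensions X v = {f. integrable lborel f \<and> (AE x in lborel. x \<in> X \<longrightarrow> f x = v x)}"

text \<open>
  \<open>H\<^sup>s(X)\<close>, \<open>s \<ge> 0\<close>, as restrictions to \<open>X\<close> of elements of \<open>H\<^sup>s(\<real>\<^sup>3)\<close>, with the quotient norm.
  Restricting to \<open>L\<^sup>1\<close> extensions, for which the Fourier integral converges, changes neither the
  space nor the norm for bounded \<open>X\<close>: multiply an extension by \<open>\<chi>(x/R)\<close> and let \<open>R \<rightarrow> \<infinity>\<close>.
\<close>

definition sobolev :: "real \<Rightarrow> pt set \<Rightarrow> field set" where
  "sobolev s X = {v. \<exists>f\<in>extensions X v. hs_energy s f < \<infinity>}"

definition sobolev_norm :: "real \<Rightarrow> pt set \<Rightarrow> field \<Rightarrow> real" where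
  "sobolev_norm s X v = sqrt (enn2real (INF f\<in>extensions X v. hs_energy s f))"

text \<open>The norm of \<open>H\<^sup>s\<^sup>+\<^sup>1(X) \<times> H\<^sup>s(X)\<close>.\<close>

definition data_norm :: "real \<Rightarrow> pt set \<Rightarrow> field \<Rightarrow> field \<Rightarrow> real" where
  "data_norm s X f0 f1 = sqrt ((sobolev_norm (s + 1) X f0)\<^sup>2 + (sobolev_norm s X f1)\<^sup>2)"

definition bounded_functional :: "real \<Rightarrow> pt set \<Rightarrow> (field \<Rightarrow> complex) \<Rightarrow> bool" where
  "bounded_functional s X Obs \<longleftrightarrow>
     (\<forall>v\<in>sobolev s X. \<forall>w\<in>sobolev s X. Obs (\<lambda>p. v p + w p) = Obs v + Obs w) \<and>
     (\<forall>v\<in>sobolev s X. \<forall>c. Obs (\<lambda>p. c * v p) = c * Obs v) \<and>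
     (\<exists>B. \<forall>v\<in>sobolev s X. cmod (Obs v) \<le> B * sobolev_norm s X v)"


section \<open>Kerr--de Sitter parameters and horizons\<close>

text \<open>A parameter is \<open>(M, a, \<Lambda>)\<close>.\<close>

type_synonym params = "real \<times> real \<times> real"

fun horizon_poly :: "params \<Rightarrow> real \<Rightarrow> real" where
  "horizon_poly (M, a, \<Lambda>) r = (r\<^sup>2 + a\<^sup>2) * (1 - \<Lambda> * r\<^sup>2 / 3) - 2 * M * r"

definition positive_simple_roots :: "params \<Rightarrow> real set" where
  "positive_simple_roots \<mu> =
     {r. 0 < r \<and> horizon_poly \<mu> r = 0 \<and> deriv (horizon_poly \<mu>) r \<noteq> 0}"

definition subextremal :: "real \<Rightarrow> (real \<times> real) set" where
  "subextremal \<Lambda> = {(M, a). \<exists>r r'. r < r' \<and>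
     r \<in> positive_simple_roots (M, a, \<Lambda>) \<and> r' \<in> positive_simple_roots (M, a, \<Lambda>)}"

text \<open>For \<open>a \<noteq> 0\<close> there is a third positive root, the Cauchy horizon, below \<open>r_event\<close>.\<close>

definition r_cosmo :: "params \<Rightarrow> real" where
  "r_cosmo \<mu> = Max (positive_simple_roots \<mu>)"

definition r_event :: "params \<Rightarrow> real" where
  "r_event \<mu> = Max (positive_simple_roots \<mu> - {r_cosmo \<mu>})"

definition rotating_params :: "real \<Rightarrow> real \<Rightarrow> params set" where
  "rotating_params a1 a0 =
     {(M, a, \<Lambda>). 0 < \<Lambda> \<and> (M, a) \<in> subextremal \<Lambda> \<and> a1 \<le> \<bar>a\<bar> \<and> \<bar>a\<bar> \<le> a0}"


section \<open>The choices entering the wave operator and the refined signals\<close>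

datatype branch = Pl | Mi

fun pm :: "branch \<Rightarrow> int" where
  "pm Pl = 1"
| "pm Mi = -1"

text \<open>
  The coordinates regular at the future horizons are obtained from Boyer--Lindquist \<open>(t, \<phi>)\<close> by
  \<open>dt = dt\<^sub>* + b (r\<^sup>2 + a\<^sup>2) f / D dr\<close> and \<open>d\<phi> = d\<phi>\<^sub>* + (b a f / D + q) dr\<close>, where \<open>D = horizon_poly\<close>,
  \<open>b = 1 + \<Lambda> a\<^sup>2 / 3\<close>, \<open>f = -1\<close> at the event and \<open>f = 1\<close> at the cosmological horizon, and \<open>q\<close> is
  smooth. \<open>prof\<close> is \<open>f\<close>, \<open>twist\<close> is \<open>q\<close>, and \<open>prof_quot\<close> is the smooth function \<open>(1 - f\<^sup>2) / D\<close>.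
  The phase-space variables of \<open>symbol\<close> are \<open>(\<theta>, \<eta>\<^sub>\<theta>, \<eta>\<^sub>\<phi>)\<close>.
\<close>

record kds_setup =
  potential :: "params \<Rightarrow> field"
  collar :: "params \<Rightarrow> real"
  prof :: "params \<Rightarrow> real \<Rightarrow> real"
  prof_quot :: "params \<Rightarrow> real \<Rightarrow> real"
  twist :: "params \<Rightarrow> real \<Rightarrow> real"
  data_region :: "params \<Rightarrow> pt set"
  spatial_cutoff :: "params \<Rightarrow> pt \<Rightarrow> real"
  time_cutoff :: "real \<Rightarrow> real"
  symbol :: "branch \<Rightarrow> real \<times> real \<times> real \<Rightarrow> complex"
  chart_cutoff :: "real \<Rightarrow> real"
  contour_height :: "params \<Rightarrow> real"

definition radial_interval :: "kds_setup \<Rightarrow> params \<Rightarrow> real set" where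
  "radial_interval S \<mu> = {r_event \<mu> - collar S \<mu> .. r_cosmo \<mu> + collar S \<mu>}"

definition slice :: "kds_setup \<Rightarrow> params \<Rightarrow> pt set" where
  "slice S \<mu> = {p. norm p \<in> radial_interval S \<mu>}"

definition phys_slice :: "params \<Rightarrow> pt set" where
  "phys_slice \<mu> = {p. r_event \<mu> < norm p \<and> norm p < r_cosmo \<mu>}"

fun sph :: "real \<Rightarrow> real \<Rightarrow> real \<Rightarrow> pt" where
  "sph r \<theta> \<phi> = (r * sin \<theta> * cos \<phi>, r * sin \<theta> * sin \<phi>, r * cos \<theta>)"

fun polar_angle :: "pt \<Rightarrow> real" where
  "polar_angle (x, y, z) = arccos (z / norm (x, y, z))"

fun azimuth :: "pt \<Rightarrow> real" where
  "azimuth (x, y, z) = Arg (Complex x y)"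

fun rotz :: "real \<Rightarrow> pt \<Rightarrow> pt" where
  "rotz \<alpha> (x, y, z) = (x * cos \<alpha> - y * sin \<alpha>, x * sin \<alpha> + y * cos \<alpha>, z)"

text \<open>
  Points where the spherical coordinates are regular. Equations between functions smooth on the
  slice are imposed there and extend to the whole slice by continuity.
\<close>

definition regular_pts :: "kds_setup \<Rightarrow> params \<Rightarrow> pt set" where
  "regular_pts S \<mu> = interior (slice S \<mu>) - {(x, y, z). x = 0 \<and> y = 0}"


section \<open>The Kerr--de Sitter wave operator\<close>

text \<open>Coordinate points are indexed by \<open>1, 2, 3, 4\<close> for \<open>t\<^sub>*, r, \<theta>, \<phi>\<^sub>*\<close>.\<close>

definition vec4 :: "'b \<Rightarrow> 'b \<Rightarrow> 'b \<Rightarrow> 'b \<Rightarrow> 'b ^ 4" where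
  "vec4 c1 c2 c3 c4 = (\<chi> i. if i = 1 then c1 else if i = 2 then c2 else if i = 3 then c3 else c4)"

fun b_coeff :: "params \<Rightarrow> real" where
  "b_coeff (M, a, \<Lambda>) = 1 + \<Lambda> * a\<^sup>2 / 3"

fun c_coeff :: "params \<Rightarrow> real \<Rightarrow> real" where
  "c_coeff (M, a, \<Lambda>) \<theta> = 1 + \<Lambda> * a\<^sup>2 / 3 * (cos \<theta>)\<^sup>2"

fun rho2 :: "params \<Rightarrow> real \<Rightarrow> real \<Rightarrow> real" where
  "rho2 (M, a, \<Lambda>) r \<theta> = r\<^sup>2 + a\<^sup>2 * (cos \<theta>)\<^sup>2"

text \<open>
  \<open>dt - a sin\<^sup>2\<theta> d\<phi>\<close> and \<open>a dt - (r\<^sup>2 + a\<^sup>2) d\<phi>\<close> in the new coordinates. Of their \<open>dr\<close> components,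
  the parts containing \<open>f / D\<close> are left out: in the second form they cancel, and in the first they
  combine with \<open>rho2 / D dr\<^sup>2\<close> into the terms with \<open>prof\<close> and \<open>prof_quot\<close> in \<open>metric_at\<close>.
\<close>

fun time_form :: "params \<Rightarrow> real \<Rightarrow> real \<Rightarrow> real ^ 4" where
  "time_form (M, a, \<Lambda>) q \<theta> = vec4 1 (- (a * (sin \<theta>)\<^sup>2 * q)) 0 (- (a * (sin \<theta>)\<^sup>2))"

fun angular_form :: "params \<Rightarrow> real \<Rightarrow> real \<Rightarrow> real ^ 4" where
  "angular_form (M, a, \<Lambda>) q r = vec4 a (- ((r\<^sup>2 + a\<^sup>2) * q)) 0 (- (r\<^sup>2 + a\<^sup>2))"

definition tensor :: "real ^ 4 \<Rightarrow> real ^ 4 \<Rightarrow> real ^ 4 ^ 4" where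
  "tensor v w = (\<chi> i j. v $ i * w $ j)"

definition metric_at :: "kds_setup \<Rightarrow> params \<Rightarrow> real \<Rightarrow> real \<Rightarrow> real ^ 4 ^ 4" where
  "metric_at S \<mu> r \<theta> =
     (let \<alpha> = time_form \<mu> (twist S \<mu> r) \<theta>; \<beta> = angular_form \<mu> (twist S \<mu> r) r;
          dr = axis 2 1; d\<theta> = axis 3 1
      in (c_coeff \<mu> \<theta> * (sin \<theta>)\<^sup>2 / ((b_coeff \<mu>)\<^sup>2 * rho2 \<mu> r \<theta>)) *\<^sub>R tensor \<beta> \<beta>
       - (horizon_poly \<mu> r / ((b_coeff \<mu>)\<^sup>2 * rho2 \<mu> r \<theta>)) *\<^sub>R tensor \<alpha> \<alpha>
       - (prof S \<mu> r / b_coeff \<mu>) *\<^sub>R (tensor \<alpha> dr + tensor dr \<alpha>)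
       + (rho2 \<mu> r \<theta> * prof_quot S \<mu> r) *\<^sub>R tensor dr dr
       + (rho2 \<mu> r \<theta> / c_coeff \<mu> \<theta>) *\<^sub>R tensor d\<theta> d\<theta>)"

definition metric :: "kds_setup \<Rightarrow> params \<Rightarrow> real ^ 4 \<Rightarrow> real ^ 4 ^ 4" where
  "metric S \<mu> x = metric_at S \<mu> (x $ 2) (x $ 3)"

abbreviation inv_metric :: "kds_setup \<Rightarrow> params \<Rightarrow> real ^ 4 \<Rightarrow> real ^ 4 ^ 4" where
  "inv_metric S \<mu> x \<equiv> matrix_inv (metric S \<mu> x)"

definition partial :: "4 \<Rightarrow> (real ^ 4 \<Rightarrow> complex) \<Rightarrow> real ^ 4 \<Rightarrow> complex" where
  "partial i F x = frechet_derivative F (at x) (axis i 1)"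

definition box_g :: "kds_setup \<Rightarrow> params \<Rightarrow> (real ^ 4 \<Rightarrow> complex) \<Rightarrow> real ^ 4 \<Rightarrow> complex" where
  "box_g S \<mu> F x =
     (\<Sum>i\<in>UNIV. partial i (\<lambda>y. of_real (sqrt \<bar>det (metric S \<mu> y)\<bar>) *
        (\<Sum>j\<in>UNIV. of_real (inv_metric S \<mu> y $ i $ j) * partial j F y)) x)
      / of_real (sqrt \<bar>det (metric S \<mu> x)\<bar>)"

definition in_coords :: "(real \<Rightarrow> field) \<Rightarrow> real ^ 4 \<Rightarrow> complex" where
  "in_coords u x = u (x $ 1) (sph (x $ 2) (x $ 3) (x $ 4))"

definition coords :: "real \<Rightarrow> pt \<Rightarrow> real ^ 4" where
  "coords t p = vec4 t (norm p) (polar_angle p) (azimuth p)"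

text \<open>\<open>\<box>\<^sub>g + V\<close>, divided by the coefficient of the second time derivative.\<close>

definition wave_op :: "kds_setup \<Rightarrow> params \<Rightarrow> (real \<Rightarrow> field) \<Rightarrow> real \<Rightarrow> field" where
  "wave_op S \<mu> u t p =
     (box_g S \<mu> (in_coords u) (coords t p) + potential S \<mu> p * u t p)
      / of_real (inv_metric S \<mu> (coords t p) $ 1 $ 1)"

text \<open>\<open>P(\<omega>) = e\<^bsup>i\<omega>t\<^esup> P e\<^bsup>-i\<omega>t\<^esup> = L - i\<omega>Q - \<omega>\<^sup>2\<close>; independent of the time at which it is evaluated.\<close>

definition spectral_family :: "kds_setup \<Rightarrow> params \<Rightarrow> complex \<Rightarrow> field \<Rightarrow> field" where
  "spectral_family S \<mu> \<omega> v p = wave_op S \<mu> (\<lambda>t p. exp (- \<i> * \<omega> * of_real t) * v p) 0 p"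


section \<open>Resolvent and quasinormal modes\<close>

definition spectral_solution :: "kds_setup \<Rightarrow> params \<Rightarrow> complex \<Rightarrow> field \<Rightarrow> field \<Rightarrow> bool" where
  "spectral_solution S \<mu> \<omega> F v \<longleftrightarrow>
     smooth_upto (slice S \<mu>) v \<and> (\<forall>p. p \<notin> slice S \<mu> \<longrightarrow> v p = 0) \<and>
     (\<forall>p\<in>regular_pts S \<mu>. spectral_family S \<mu> \<omega> v p = F p)"

text \<open>
  The outgoing condition is smoothness across the future horizons: away from the poles,
  \<open>P(\<omega>)\<close> is bijective on \<open>C\<^sup>\<infinity>(X)\<close> and its inverse is the meromorphic continuation of the
  resolvent from large \<open>Im \<omega>\<close>. The value at a pole itself is unspecified.
\<close>

definition resolvent :: "kds_setup \<Rightarrow> params \<Rightarrow> complex \<Rightarrow> field \<Rightarrow> field" where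
  "resolvent S \<mu> \<omega> F = (THE v. spectral_solution S \<mu> \<omega> F v)"

definition in_sector :: "int \<Rightarrow> field \<Rightarrow> bool" where
  "in_sector k v \<longleftrightarrow> (\<forall>\<alpha> p. v (rotz \<alpha> p) = exp (\<i> * of_int k * of_real \<alpha>) * v p)"

definition sector_qnm :: "kds_setup \<Rightarrow> params \<Rightarrow> int \<Rightarrow> complex \<Rightarrow> bool" where
  "sector_qnm S \<mu> k \<omega> \<longleftrightarrow>
     (\<exists>F p. smooth_upto (slice S \<mu>) F \<and> in_sector k F \<and> p \<in> slice S \<mu> \<and>
            is_pole (\<lambda>\<zeta>. resolvent S \<mu> \<zeta> F p) \<omega>)"

text \<open>A pole of order one whose residue has rank one, within the sector.\<close>

definition simple_sector_qnm :: "kds_setup \<Rightarrow> params \<Rightarrow> int \<Rightarrow> complex \<Rightarrow> bool" where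
  "simple_sector_qnm S \<mu> k \<omega> \<longleftrightarrow> sector_qnm S \<mu> k \<omega> \<and>
     (\<exists>v. \<forall>F. smooth_upto (slice S \<mu>) F \<and> in_sector k F \<longrightarrow>
        (\<exists>c. \<forall>p\<in>slice S \<mu>.
           ((\<lambda>\<zeta>. (\<zeta> - \<omega>) * resolvent S \<mu> \<zeta> F p) \<longlongrightarrow> c * v p) (at \<omega>)))"


section \<open>Solutions and refined signals\<close>

text \<open>
  Smooth solutions on \<open>[0, \<infinity>) \<times> X\<close> with data supported in the fixed region. The slice has no
  boundary condition: its boundary hypersurfaces are spacelike and lie beyond the horizons.
\<close>

definition wave_solution ::
    "kds_setup \<Rightarrow> params \<Rightarrow> field \<Rightarrow> field \<Rightarrow> (real \<Rightarrow> field) \<Rightarrow> bool" where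
  "wave_solution S \<mu> f0 f1 u \<longleftrightarrow>
     smooth_upto ({0..} \<times> slice S \<mu>) (\<lambda>(t, p). u t p) \<and>
     (\<forall>t>0. \<forall>p\<in>regular_pts S \<mu>. wave_op S \<mu> u t p = 0) \<and>
     (\<forall>p\<in>slice S \<mu>. u 0 p = f0 p \<and> ((\<lambda>t. u t p) has_vector_derivative f1 p) (at 0 within {0..})) \<and>
     {p. f0 p \<noteq> 0} \<subseteq> data_region S \<mu> \<and> {p. f1 p \<noteq> 0} \<subseteq> data_region S \<mu>"

definition forcing :: "kds_setup \<Rightarrow> params \<Rightarrow> (real \<Rightarrow> field) \<Rightarrow> real \<Rightarrow> field" where
  "forcing S \<mu> u = wave_op S \<mu> (\<lambda>t p. of_real (time_cutoff S t) * u t p)"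

definition forcing_hat :: "kds_setup \<Rightarrow> params \<Rightarrow> (real \<Rightarrow> field) \<Rightarrow> complex \<Rightarrow> field" where
  "forcing_hat S \<mu> u \<omega> p =
     (LINT t:{0..1}|lborel. exp (\<i> * \<omega> * of_real t) * forcing S \<mu> u t p)"

definition forcing_support :: "kds_setup \<Rightarrow> params \<Rightarrow> pt set" where
  "forcing_support S \<mu> = closure {p \<in> regular_pts S \<mu>.
     \<exists>f0 f1 u t. wave_solution S \<mu> f0 f1 u \<and> forcing S \<mu> u t p \<noteq> 0}"

definition sector_proj :: "int \<Rightarrow> field \<Rightarrow> field" where
  "sector_proj k v p =
     (LINT \<alpha>:{0..2 * pi}|lborel. exp (- \<i> * of_int k * of_real \<alpha>) * v (rotz \<alpha> p)) / of_real (2 * pi)"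

text \<open>
  The standard (left) semiclassical quantization of a \<open>\<phi>\<^sub>*\<close>-independent symbol in the chart
  \<open>(\<theta>, \<phi>\<^sub>*)\<close>, cut off away from the poles by \<open>chart_cutoff\<close> and acting as the identity in \<open>r\<close>.
  On the \<open>k\<close>-th Fourier mode in \<open>\<phi>\<^sub>*\<close> the quantization of \<open>\<eta>\<^sub>\<phi>\<close> is multiplication by \<open>h k\<close>.
\<close>

definition microlocal_cutoff :: "kds_setup \<Rightarrow> branch \<Rightarrow> real \<Rightarrow> field \<Rightarrow> field" where
  "microlocal_cutoff S \<sigma> h v p =
     (\<Sum>\<^sub>\<infinity>k\<in>(UNIV :: int set). (LINT \<eta>|lborel. (LINT \<theta>':{0..pi}|lborel.
         exp (\<i> * of_real ((polar_angle p - \<theta>') * \<eta> / h)) *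
         symbol S \<sigma> (polar_angle p, \<eta>, h * of_int k) * of_real (chart_cutoff S \<theta>') *
         sector_proj k v (sph (norm p) \<theta>' (azimuth p)))) / of_real (2 * pi * h))"

definition near_equator :: "branch \<Rightarrow> real \<Rightarrow> (real \<times> real \<times> real) set" where
  "near_equator \<sigma> d = {(\<theta>, \<eta>\<theta>, \<eta>\<phi>).
     \<bar>\<theta> - pi / 2\<bar> \<le> d \<and> \<bar>\<eta>\<theta>\<bar> \<le> d \<and> \<bar>\<eta>\<phi> - of_int (pm \<sigma>)\<bar> \<le> d}"

definition valid_setup :: "kds_setup \<Rightarrow> params set \<Rightarrow> bool" where
  "valid_setup S K \<longleftrightarrow>
     smooth_on UNIV (time_cutoff S) \<and>
     (\<forall>t\<le>0. time_cutoff S t = 0) \<and> (\<forall>t\<ge>1. time_cutoff S t = 1) \<and>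
     (\<forall>\<sigma>. smooth_on UNIV (symbol S \<sigma>) \<and>
        (\<exists>d d'. 0 < d' \<and> d' < d \<and> d < 1 \<and> supp (symbol S \<sigma>) \<subseteq> near_equator \<sigma> d \<and>
                (\<forall>z\<in>near_equator \<sigma> d'. symbol S \<sigma> z = 1))) \<and>
     (\<forall>z. symbol S Pl z * symbol S Mi z = 0) \<and>
     smooth_on UNIV (chart_cutoff S) \<and> supp (chart_cutoff S) \<subseteq> {0<..<pi} \<and>
     (\<forall>\<theta>. \<bar>\<theta> - pi / 2\<bar> \<le> 1 \<longrightarrow> chart_cutoff S \<theta> = 1) \<and>
     (\<forall>\<mu>\<in>K.
        0 < collar S \<mu> \<and> collar S \<mu> < r_event \<mu> \<and>
        (\<forall>r\<in>radial_interval S \<mu>. horizon_poly \<mu> r = 0 \<longrightarrow> r \<in> {r_event \<mu>, r_cosmo \<mu>}) \<and>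
        smooth_upto (radial_interval S \<mu>) (prof S \<mu>) \<and>
        smooth_upto (radial_interval S \<mu>) (prof_quot S \<mu>) \<and>
        smooth_upto (radial_interval S \<mu>) (twist S \<mu>) \<and>
        prof S \<mu> (r_event \<mu>) = -1 \<and> prof S \<mu> (r_cosmo \<mu>) = 1 \<and>
        (\<forall>r\<in>radial_interval S \<mu>. 1 - (prof S \<mu> r)\<^sup>2 = horizon_poly \<mu> r * prof_quot S \<mu> r) \<and>
        \<comment> \<open>the level sets of \<open>t\<^sub>*\<close> are spacelike\<close>
        (\<forall>p\<in>slice S \<mu> - {(x, y, z). x = 0 \<and> y = 0}. inv_metric S \<mu> (coords 0 p) $ 1 $ 1 < 0) \<and>
        smooth_upto (slice S \<mu>) (potential S \<mu>) \<and>
        (\<forall>p \<alpha>. potential S \<mu> (rotz \<alpha> p) = potential S \<mu> p) \<and>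
        compact (data_region S \<mu>) \<and> data_region S \<mu> \<subseteq> phys_slice \<mu> \<and>
        smooth_on UNIV (spatial_cutoff S \<mu>) \<and>
        compact (supp (spatial_cutoff S \<mu>)) \<and> supp (spatial_cutoff S \<mu>) \<subseteq> phys_slice \<mu> \<and>
        (\<exists>U. open U \<and> forcing_support S \<mu> \<subseteq> U \<and> (\<forall>p\<in>U. spatial_cutoff S \<mu> p = 1)) \<and>
        \<comment> \<open>the contour lies above all quasinormal modes\<close>
        0 < contour_height S \<mu> \<and>
        (\<forall>\<omega> F. contour_height S \<mu> \<le> Im \<omega> \<and> smooth_upto (slice S \<mu>) F \<longrightarrow>
               (\<exists>!v. spectral_solution S \<mu> \<omega> F v)))"

text \<open>
  \<open>qnm j \<sigma> l \<mu>\<close> and \<open>pseudopole j \<sigma> l \<mu>\<close> are the exact and approximate frequencies of overtone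
  \<open>j\<close> in the sector \<open>k = \<plusminus>l\<close>; \<open>amplitude \<sigma> l \<mu> f0 f1\<close> is the coefficient of the \<open>n\<close>-th overtone.
\<close>

record mode_family =
  qnm :: "nat \<Rightarrow> branch \<Rightarrow> nat \<Rightarrow> params \<Rightarrow> complex"
  pseudopole :: "nat \<Rightarrow> branch \<Rightarrow> nat \<Rightarrow> params \<Rightarrow> complex"
  amplitude :: "branch \<Rightarrow> nat \<Rightarrow> params \<Rightarrow> field \<Rightarrow> field \<Rightarrow> field"

definition equatorial_modes ::
    "kds_setup \<Rightarrow> mode_family \<Rightarrow> nat \<Rightarrow> params set \<Rightarrow> nat \<Rightarrow> bool" where
  "equatorial_modes S F n K l0 \<longleftrightarrow>
     (\<forall>\<mu>\<in>K. \<forall>l\<ge>l0. \<forall>\<sigma>.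
        (\<forall>j\<le>n + 1. simple_sector_qnm S \<mu> (pm \<sigma> * int l) (qnm F j \<sigma> l \<mu>)) \<and>
        Im (qnm F n \<sigma> l \<mu>) \<le> 0 \<and>
        pseudopole F n \<sigma> l \<mu> \<noteq> 0 \<and> (\<forall>j<n. pseudopole F n \<sigma> l \<mu> \<noteq> pseudopole F j \<sigma> l \<mu>)) \<and>
     (\<forall>N::nat. \<exists>C. \<forall>\<mu>\<in>K. \<forall>l\<ge>l0. \<forall>\<sigma>. \<forall>j\<le>n + 1.
        cmod (qnm F j \<sigma> l \<mu> - pseudopole F j \<sigma> l \<mu>) \<le> C / real l ^ N)"

definition filter_poly ::
    "mode_family \<Rightarrow> nat \<Rightarrow> branch \<Rightarrow> nat \<Rightarrow> params \<Rightarrow> complex \<Rightarrow> complex" where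
  "filter_poly F n \<sigma> l \<mu> \<omega> = (\<omega> / pseudopole F n \<sigma> l \<mu>) ^ (n + 2) *
     (\<Prod>j<n. (\<omega> - pseudopole F j \<sigma> l \<mu>) / (pseudopole F n \<sigma> l \<mu> - pseudopole F j \<sigma> l \<mu>))"

definition refined_signal ::
    "kds_setup \<Rightarrow> mode_family \<Rightarrow> nat \<Rightarrow> branch \<Rightarrow> nat \<Rightarrow> params \<Rightarrow> (real \<Rightarrow> field) \<Rightarrow> real \<Rightarrow> field" where
  "refined_signal S F n \<sigma> l \<mu> u t = (\<lambda>p. of_real (spatial_cutoff S \<mu> p) *
     microlocal_cutoff S \<sigma> (1 / real l) (sector_proj (pm \<sigma> * int l)
       (\<lambda>p'. (LINT x|lborel. (let \<omega> = Complex x (contour_height S \<mu>) in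
           exp (- \<i> * \<omega> * of_real t) * filter_poly F n \<sigma> l \<mu> \<omega> *
           resolvent S \<mu> \<omega> (forcing_hat S \<mu> u \<omega>) p')) / of_real (2 * pi))) p)"

definition remainder_term ::
    "kds_setup \<Rightarrow> mode_family \<Rightarrow> nat \<Rightarrow> branch \<Rightarrow> nat \<Rightarrow> params \<Rightarrow> field \<Rightarrow> field \<Rightarrow>
     (real \<Rightarrow> field) \<Rightarrow> real \<Rightarrow> field" where
  "remainder_term S F n \<sigma> l \<mu> f0 f1 u t = (\<lambda>p. refined_signal S F n \<sigma> l \<mu> u t p -
     exp (- \<i> * qnm F n \<sigma> l \<mu> * of_real t) * amplitude F \<sigma> l \<mu> f0 f1 p)"


section \<open>Two-mode decomposition\<close>

definition separating_line ::
    "kds_setup \<Rightarrow> mode_family \<Rightarrow> nat \<Rightarrow> params set \<Rightarrow> nat \<Rightarrow> real \<Rightarrow> bool" where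
  "separating_line S F n K l0 \<nu> \<longleftrightarrow> 0 < \<nu> \<and>
     (\<exists>\<gamma>>0. \<forall>\<mu>\<in>K. \<forall>l\<ge>l0. \<forall>\<sigma>.
        (\<forall>\<omega>. sector_qnm S \<mu> (pm \<sigma> * int l) \<omega> \<longrightarrow> \<gamma> \<le> \<bar>Im \<omega> + \<nu>\<bar>) \<and>
        (\<forall>j\<le>n. - \<nu> < Im (qnm F j \<sigma> l \<mu>)) \<and> Im (qnm F (n + 1) \<sigma> l \<mu>) < - \<nu>)"

definition admissible_data :: "kds_setup \<Rightarrow> params \<Rightarrow> field \<Rightarrow> bool" where
  "admissible_data S \<mu> f \<longleftrightarrow>
     smooth_upto (slice S \<mu>) f \<and> {p. f p \<noteq> 0} \<subseteq> data_region S \<mu>"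

definition linear_amplitude ::
    "kds_setup \<Rightarrow> real \<Rightarrow> params \<Rightarrow> (field \<Rightarrow> field \<Rightarrow> field) \<Rightarrow> bool" where
  "linear_amplitude S s \<mu> A \<longleftrightarrow>
     (\<forall>f0 f1. admissible_data S \<mu> f0 \<and> admissible_data S \<mu> f1 \<longrightarrow>
        A f0 f1 \<in> sobolev (s + 1) (slice S \<mu>) \<and>
        (\<forall>c. AE p in lborel. p \<in> slice S \<mu> \<longrightarrow>
           A (\<lambda>q. c * f0 q) (\<lambda>q. c * f1 q) p = c * A f0 f1 p) \<and>
        (\<forall>g0 g1. admissible_data S \<mu> g0 \<and> admissible_data S \<mu> g1 \<longrightarrow>
           (AE p in lborel. p \<in> slice S \<mu> \<longrightarrow>
              A (\<lambda>q. f0 q + g0 q) (\<lambda>q. f1 q + g1 q) p = A f0 f1 p + A g0 g1 p)))"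

definition two_mode_decomposition ::
    "kds_setup \<Rightarrow> mode_family \<Rightarrow> nat \<Rightarrow> real \<Rightarrow> params set \<Rightarrow> nat \<Rightarrow> real \<Rightarrow> bool" where
  "two_mode_decomposition S F n s K l0 \<nu> \<longleftrightarrow>
     separating_line S F n K l0 \<nu> \<and>
     (\<forall>\<mu>\<in>K. \<forall>l\<ge>l0. \<forall>\<sigma>. linear_amplitude S s \<mu> (amplitude F \<sigma> l \<mu>)) \<and>
     (\<forall>m N'::nat. \<exists>(N::nat) C. \<forall>\<mu>\<in>K. \<forall>l\<ge>l0. \<forall>\<sigma> f0 f1 u. wave_solution S \<mu> f0 f1 u \<longrightarrow>
        (\<forall>t\<ge>1. remainder_term S F n \<sigma> l \<mu> f0 f1 u t \<in> sobolev (s + 1) (slice S \<mu>) \<and>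
           sobolev_norm (s + 1) (slice S \<mu>) (remainder_term S F n \<sigma> l \<mu> f0 f1 u t)
             \<le> C * (exp (- \<nu> * t) * (1 + t) powr (- real m) + real l powr (- real N')) *
                data_norm (s + real m + real N) (slice S \<mu>) f0 f1))"


section \<open>Observation and frequency estimators\<close>

record obs_window =
  start :: real
  duration :: real
  shift_step :: real
  weight :: "real \<Rightarrow> real"

definition valid_window :: "obs_window \<Rightarrow> bool" where
  "valid_window W \<longleftrightarrow> 1 \<le> start W \<and> 0 < shift_step W \<and> shift_step W < duration W \<and>
     set_borel_measurable lborel {start W .. start W + duration W - shift_step W} (weight W) \<and>
     (\<forall>t\<in>{start W .. start W + duration W - shift_step W}. 0 \<le> weight W t \<and> weight W t \<le> 1) \<and>
     (\<forall>t\<in>{start W + shift_step W .. start W + duration W - 2 * shift_step W}. weight W t = 1)"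

definition inner_w :: "obs_window \<Rightarrow> (real \<Rightarrow> complex) \<Rightarrow> (real \<Rightarrow> complex) \<Rightarrow> complex" where
  "inner_w W f g = (LINT t:{start W .. start W + duration W - shift_step W}|lborel.
     of_real (weight W t) * f t * cnj (g t))"

definition norm_w :: "obs_window \<Rightarrow> (real \<Rightarrow> complex) \<Rightarrow> real" where
  "norm_w W f = sqrt (Re (inner_w W f f))"

definition shifted :: "obs_window \<Rightarrow> (real \<Rightarrow> complex) \<Rightarrow> real \<Rightarrow> complex" where
  "shifted W f t = f (t + shift_step W)"

record measurement =
  position_data :: field
  velocity_data :: field
  wave :: "real \<Rightarrow> field"
  observable :: "field \<Rightarrow> complex"
  noise :: "branch \<Rightarrow> real \<Rightarrow> complex"

definition valid_measurement ::
    "kds_setup \<Rightarrow> real \<Rightarrow> obs_window \<Rightarrow> params \<Rightarrow> measurement \<Rightarrow> bool" where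
  "valid_measurement S s W \<mu> X \<longleftrightarrow>
     wave_solution S \<mu> (position_data X) (velocity_data X) (wave X) \<and>
     bounded_functional (s + 1) (slice S \<mu>) (observable X) \<and>
     (\<forall>\<sigma>. set_borel_measurable lborel {start W .. start W + duration W} (noise X \<sigma>) \<and>
          set_integrable lborel {start W .. start W + duration W} (\<lambda>t. (cmod (noise X \<sigma> t))\<^sup>2))"

definition coefficient :: "mode_family \<Rightarrow> measurement \<Rightarrow> branch \<Rightarrow> nat \<Rightarrow> params \<Rightarrow> complex" where
  "coefficient F X \<sigma> l \<mu> =
     observable X (amplitude F \<sigma> l \<mu> (position_data X) (velocity_data X))"

definition clean_signal ::
    "mode_family \<Rightarrow> nat \<Rightarrow> measurement \<Rightarrow> branch \<Rightarrow> nat \<Rightarrow> params \<Rightarrow> real \<Rightarrow> complex" where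
  "clean_signal F n X \<sigma> l \<mu> t =
     coefficient F X \<sigma> l \<mu> * exp (- \<i> * qnm F n \<sigma> l \<mu> * of_real t)"

definition residual ::
    "kds_setup \<Rightarrow> mode_family \<Rightarrow> nat \<Rightarrow> measurement \<Rightarrow> branch \<Rightarrow> nat \<Rightarrow> params \<Rightarrow> real \<Rightarrow> complex" where
  "residual S F n X \<sigma> l \<mu> t =
     observable X (remainder_term S F n \<sigma> l \<mu> (position_data X) (velocity_data X) (wave X) t)
     + noise X \<sigma> t"

definition measured_signal ::
    "kds_setup \<Rightarrow> mode_family \<Rightarrow> nat \<Rightarrow> measurement \<Rightarrow> branch \<Rightarrow> nat \<Rightarrow> params \<Rightarrow> real \<Rightarrow> complex" where
  "measured_signal S F n X \<sigma> l \<mu> t =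
     observable X (refined_signal S F n \<sigma> l \<mu> (wave X) t) + noise X \<sigma> t"

definition rel_residual ::
    "kds_setup \<Rightarrow> mode_family \<Rightarrow> nat \<Rightarrow> obs_window \<Rightarrow> measurement \<Rightarrow> branch \<Rightarrow> nat \<Rightarrow> params \<Rightarrow> real" where
  "rel_residual S F n W X \<sigma> l \<mu> =
     max (norm_w W (residual S F n X \<sigma> l \<mu>)) (norm_w W (shifted W (residual S F n X \<sigma> l \<mu>)))
      / norm_w W (clean_signal F n X \<sigma> l \<mu>)"

definition multiplier :: "obs_window \<Rightarrow> complex \<Rightarrow> complex" where
  "multiplier W \<omega> = exp (- \<i> * \<omega> * of_real (shift_step W))"

definition est_multiplier :: "obs_window \<Rightarrow> (real \<Rightarrow> complex) \<Rightarrow> complex" where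
  "est_multiplier W y = inner_w W (shifted W y) y / inner_w W y y"

text \<open>The logarithm branch selected by the prior frequency \<open>\<omega>p\<close>.\<close>

definition prior_log :: "obs_window \<Rightarrow> complex \<Rightarrow> complex \<Rightarrow> complex" where
  "prior_log W \<omega>p \<zeta> = Ln (\<zeta> / multiplier W \<omega>p) - \<i> * \<omega>p * of_real (shift_step W)"

definition est_freq ::
    "kds_setup \<Rightarrow> mode_family \<Rightarrow> nat \<Rightarrow> obs_window \<Rightarrow> measurement \<Rightarrow> branch \<Rightarrow> nat \<Rightarrow> params \<Rightarrow> complex" where
  "est_freq S F n W X \<sigma> l \<mu> = \<i> / of_real (shift_step W) *
     prior_log W (pseudopole F n \<sigma> l \<mu>) (est_multiplier W (measured_signal S F n X \<sigma> l \<mu>))"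

text \<open>
  Uniform over the true parameters, the data, the functional and the noise; the window is fixed, since
  the admissible \<open>l\<close> depend on the shift through the branch of the logarithm.
\<close>

definition frequency_error_estimate ::
    "kds_setup \<Rightarrow> mode_family \<Rightarrow> nat \<Rightarrow> real \<Rightarrow> params set \<Rightarrow> nat \<Rightarrow> obs_window \<Rightarrow> bool" where
  "frequency_error_estimate S F n s K l0 W \<longleftrightarrow>
     (\<forall>\<mu>\<in>K. \<forall>l\<ge>l0. \<forall>\<sigma> X. valid_measurement S s W \<mu> X \<longrightarrow>
        coefficient F X \<sigma> l \<mu> \<noteq> 0 \<longrightarrow> Im (qnm F n \<sigma> l \<mu>) \<le> 0 \<longrightarrow>
        rel_residual S F n W X \<sigma> l \<mu> \<le> min (1 / 8) (cmod (multiplier W (qnm F n \<sigma> l \<mu>)) / 20) \<longrightarrow>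
        cmod (est_freq S F n W X \<sigma> l \<mu> - qnm F n \<sigma> l \<mu>)
          \<le> 10 / (shift_step W * cmod (multiplier W (qnm F n \<sigma> l \<mu>))) * rel_residual S F n W X \<sigma> l \<mu>)"


section \<open>The three-parameter data map and its local inverses\<close>

definition freq_data :: "nat \<Rightarrow> nat \<Rightarrow> (branch \<Rightarrow> complex) \<Rightarrow> real \<times> real \<times> real" where
  "freq_data n l \<omega> =
     (Re ((\<omega> Pl + \<omega> Mi) / of_real (2 * real l)),
      Re ((\<omega> Pl - \<omega> Mi) / of_real (2 * real l)),
      - Im (\<omega> Pl) / (real n + 1 / 2))"

definition data_map :: "mode_family \<Rightarrow> nat \<Rightarrow> nat \<Rightarrow> params \<Rightarrow> real \<times> real \<times> real" where
  "data_map F n l \<mu> = freq_data n l (\<lambda>\<sigma>. qnm F n \<sigma> l \<mu>)"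

definition est_data ::
    "kds_setup \<Rightarrow> mode_family \<Rightarrow> nat \<Rightarrow> obs_window \<Rightarrow> measurement \<Rightarrow> nat \<Rightarrow> params \<Rightarrow> real \<times> real \<times> real" where
  "est_data S F n W X l \<mu> = freq_data n l (\<lambda>\<sigma>. est_freq S F n W X \<sigma> l \<mu>)"

fun monomial3 :: "nat \<times> nat \<times> nat \<Rightarrow> real \<times> real \<times> real \<Rightarrow> real" where
  "monomial3 (i, j, k) (x, y, z) = x ^ i * y ^ j * z ^ k"

text \<open>For a set with boundary: restriction of a real-analytic map defined near each point.\<close>

definition real_analytic_on3 ::
    "(real \<times> real \<times> real) set \<Rightarrow> (real \<times> real \<times> real \<Rightarrow> 'b::real_normed_vector) \<Rightarrow> bool" where
  "real_analytic_on3 K f \<longleftrightarrow> (\<forall>x\<in>K. \<exists>e>0. \<exists>c.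
     \<forall>y\<in>ball x e. (\<lambda>i. norm (monomial3 i (y - x) *\<^sub>R c i)) summable_on UNIV \<and>
       (y \<in> K \<longrightarrow> ((\<lambda>i. monomial3 i (y - x) *\<^sub>R c i) has_sum f y) UNIV))"

text \<open>\<open>nbhd l \<mu>\<close> is the neighborhood of \<open>\<mu>\<close> in \<open>K\<close> on which the data map is stably injective.\<close>

definition inverse_stability ::
    "mode_family \<Rightarrow> nat \<Rightarrow> params set \<Rightarrow> nat \<Rightarrow> real \<Rightarrow> (nat \<Rightarrow> params \<Rightarrow> params set) \<Rightarrow> bool" where
  "inverse_stability F n K l0 Cstar nbhd \<longleftrightarrow> 0 < Cstar \<and>
     (\<forall>l\<ge>l0. real_analytic_on3 K (data_map F n l) \<and>
        (\<forall>\<mu>\<in>K. \<mu> \<in> nbhd l \<mu> \<and> openin (top_of_set K) (nbhd l \<mu>) \<and>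
           inj_on (data_map F n l) (nbhd l \<mu>) \<and>
           (\<forall>\<mu>1\<in>nbhd l \<mu>. \<forall>\<mu>2\<in>nbhd l \<mu>.
              norm (\<mu>1 - \<mu>2) \<le> Cstar * norm (data_map F n l \<mu>1 - data_map F n l \<mu>2))))"

text \<open>Only meaningful when the estimated data lie in the range of the local inverse.\<close>

definition reconstructed ::
    "kds_setup \<Rightarrow> mode_family \<Rightarrow> nat \<Rightarrow> obs_window \<Rightarrow> measurement \<Rightarrow> nat \<Rightarrow>
     (nat \<Rightarrow> params \<Rightarrow> params set) \<Rightarrow> params \<Rightarrow> params" where
  "reconstructed S F n W X l nbhd \<mu> =
     the_inv_into (nbhd l \<mu>) (data_map F n l) (est_data S F n W X l \<mu>)"

end

theory Submission
  imports Defs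
begin

text \<open>The estimate is error propagation through an inverse that is Lipschitz on a
  neighborhood. The frequency-error estimate bounds the error in each branch by
  \<open>e \<sigma>\<close>, that is 10/\<Delta> times the relative residual over the modulus of the
  multiplier. \<open>freq_data\<close> is real-linear in the two frequencies, so
  \<open>norm_freq_data_diff_le\<close> turns these bounds into one on the data. Both the
  reconstructed and the true parameters lie in \<open>nbhd l \<mu>\<close>, where
  \<open>inverse_stability\<close> bounds their distance by \<open>Cstar\<close> times the data
  error.\<close>

text \<open>The first two components come from the real-part errors by (x, y) -> (x + y, x - y),
  which scales the Euclidean norm by exactly sqrt 2; bounding each component separately would lose a
  factor sqrt 2. The third component sees only the \<open>Pl\<close> branch, which explains the
  asymmetric last term.\<close>

lemma norm_freq_data_diff_le:
  fixes \<omega> \<omega>' :: "branch \<Rightarrow> complex"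
  assumes l: "0 < l" and d: "\<And>\<sigma>. cmod (\<omega> \<sigma> - \<omega>' \<sigma>) \<le> e \<sigma>"
  shows "norm (freq_data n l \<omega> - freq_data n l \<omega>')
    \<le> sqrt 2 / (2 * real l) * (e Pl + e Mi) + e Pl / (real n + 1 / 2)"
proof -
  define x where "x = Re (\<omega> Pl - \<omega>' Pl)"
  define y where "y = Re (\<omega> Mi - \<omega>' Mi)"
  define v where "v = Im (\<omega> Pl - \<omega>' Pl)"
  have x: "\<bar>x\<bar> \<le> e Pl" and y: "\<bar>y\<bar> \<le> e Mi" and v: "\<bar>v\<bar> \<le> e Pl"
    unfolding x_def y_def v_def
    using abs_Re_le_cmod abs_Im_le_cmod d order_trans by blast+
  have diff: "freq_data n l \<omega> - freq_data n l \<omega>' =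
      ((x + y) / (2 * real l), (x - y) / (2 * real l), - v / (real n + 1 / 2))"
    unfolding freq_data_def Re_divide_of_real x_def y_def v_def
    by (simp add: diff_divide_distrib add_divide_distrib)
  let ?A = "((x + y) / (2 * real l))\<^sup>2 + ((x - y) / (2 * real l))\<^sup>2"
  \<comment> \<open>Parallelogram law: the cross terms cancel.\<close>
  have A: "?A = 2 * (x\<^sup>2 + y\<^sup>2) / (2 * real l)\<^sup>2"
    unfolding power_divide add_divide_distrib[symmetric] by (simp add: power2_sum power2_diff)
  have "sqrt (x\<^sup>2 + y\<^sup>2) \<le> e Pl + e Mi"
    using sqrt_sum_squares_le_sum_abs[of x y] x y by linarith
  then have "sqrt ?A \<le> sqrt 2 / (2 * real l) * (e Pl + e Mi)"
    unfolding A real_sqrt_divide real_sqrt_abs real_sqrt_mult using l by (simp add: divide_right_mono)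
  moreover have "\<bar>v\<bar> / (real n + 1 / 2) \<le> e Pl / (real n + 1 / 2)"
    using v by (intro divide_right_mono) auto
  \<comment> \<open>Subadditivity of the square root splits the damping component off from the other
    two.\<close>
  moreover have "norm (freq_data n l \<omega> - freq_data n l \<omega>') \<le> sqrt ?A + \<bar>v\<bar> / (real n + 1 / 2)"
  proof -
    have "norm (freq_data n l \<omega> - freq_data n l \<omega>') = sqrt (?A + (v / (real n + 1 / 2))\<^sup>2)"
      unfolding diff norm_Pair by (simp add: power_divide)
    also have "\<dots> \<le> sqrt ?A + sqrt ((v / (real n + 1 / 2))\<^sup>2)"
      by (intro sqrt_add_le_add_sqrt) auto
    finally show ?thesis
      by simp
  qed
  ultimately show ?thesis
    by linarith
qed

theorem theorem7p20:
  fixes S :: kds_setup and F :: mode_family and W :: obs_window and X :: measurement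
    and n l0 l :: nat and s a0 a1 \<nu> Cstar :: real
    and K :: "params set" and nbhd :: "nat \<Rightarrow> params \<Rightarrow> params set" and \<mu> :: params
  assumes "0 < a1" and "compact K" and "K \<subseteq> rotating_params a1 a0"
    and "0 \<le> s" and "1 \<le> l0"
    and "valid_setup S K"
    and "equatorial_modes S F n K l0"
    and "valid_window W"
    and decomposition: "two_mode_decomposition S F n s K l0 \<nu>"
    and frequency_error: "frequency_error_estimate S F n s K l0 W"
    and stability: "inverse_stability F n K l0 Cstar nbhd"
    and "l0 \<le> l" and "\<mu> \<in> K"
    and "valid_measurement S s W \<mu> X"
    and detectability: "coefficient F X Pl l \<mu> \<noteq> 0" "coefficient F X Mi l \<mu> \<noteq> 0"
    and small_residual: "\<And>\<sigma>. rel_residual S F n W X \<sigma> l \<mu>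
           \<le> min (1 / 8) (cmod (multiplier W (qnm F n \<sigma> l \<mu>)) / 20)"
    and in_range: "est_data S F n W X l \<mu> \<in> data_map F n l ` nbhd l \<mu>"
  shows "norm (reconstructed S F n W X l nbhd \<mu> - \<mu>)
    \<le> 5 * sqrt 2 * Cstar / (shift_step W * real l) *
        (rel_residual S F n W X Pl l \<mu> / cmod (multiplier W (qnm F n Pl l \<mu>)) +
         rel_residual S F n W X Mi l \<mu> / cmod (multiplier W (qnm F n Mi l \<mu>)))
      + 10 * Cstar / (shift_step W * (real n + 1 / 2)) *
        (rel_residual S F n W X Pl l \<mu> / cmod (multiplier W (qnm F n Pl l \<mu>)))"
proof -
  define e where "e \<sigma> = 10 / (shift_step W * cmod (multiplier W (qnm F n \<sigma> l \<mu>)))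
    * rel_residual S F n W X \<sigma> l \<mu>" for \<sigma>
  let ?est = "est_data S F n W X l \<mu>" and ?rec = "reconstructed S F n W X l nbhd \<mu>"
  have l: "0 < l"
    using \<open>1 \<le> l0\<close> \<open>l0 \<le> l\<close> by simp
  have "coefficient F X \<sigma> l \<mu> \<noteq> 0" for \<sigma>
    using detectability by (cases \<sigma>) auto
  moreover have "Im (qnm F n \<sigma> l \<mu>) \<le> 0" for \<sigma>
    using \<open>equatorial_modes S F n K l0\<close> \<open>\<mu> \<in> K\<close> \<open>l0 \<le> l\<close> by (auto simp: equatorial_modes_def)
  ultimately have "cmod (est_freq S F n W X \<sigma> l \<mu> - qnm F n \<sigma> l \<mu>) \<le> e \<sigma>" for \<sigma>
    using frequency_error \<open>\<mu> \<in> K\<close> \<open>l0 \<le> l\<close> \<open>valid_measurement S s W \<mu> X\<close> small_residual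
    unfolding frequency_error_estimate_def e_def by blast
  then have data: "norm (?est - data_map F n l \<mu>)
      \<le> sqrt 2 / (2 * real l) * (e Pl + e Mi) + e Pl / (real n + 1 / 2)"
    unfolding est_data_def data_map_def by (intro norm_freq_data_diff_le l)
  have C: "0 < Cstar" and \<mu>: "\<mu> \<in> nbhd l \<mu>" and inj: "inj_on (data_map F n l) (nbhd l \<mu>)"
    and stable: "\<forall>\<mu>1\<in>nbhd l \<mu>. \<forall>\<mu>2\<in>nbhd l \<mu>.
      norm (\<mu>1 - \<mu>2) \<le> Cstar * norm (data_map F n l \<mu>1 - data_map F n l \<mu>2)"
    using stability \<open>\<mu> \<in> K\<close> \<open>l0 \<le> l\<close> unfolding inverse_stability_def by blast+
  \<comment> \<open>\<open>the_inv_into\<close> is a definite description; \<open>in_range\<close>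
    and injectivity make it a genuine preimage inside the neighborhood.\<close>
  have "?rec \<in> nbhd l \<mu>" and "data_map F n l ?rec = ?est"
    unfolding reconstructed_def
    using the_inv_into_into[OF inj in_range order_refl] f_the_inv_into_f[OF inj in_range] by auto
  then have "norm (?rec - \<mu>) \<le> Cstar * norm (?est - data_map F n l \<mu>)"
    using stable \<mu> by metis
  also have "\<dots> \<le> Cstar * (sqrt 2 / (2 * real l) * (e Pl + e Mi) + e Pl / (real n + 1 / 2))"
    using data C by (intro mult_left_mono) auto
  also have "\<dots> = 5 * sqrt 2 * Cstar / (shift_step W * real l) *
        (rel_residual S F n W X Pl l \<mu> / cmod (multiplier W (qnm F n Pl l \<mu>)) +
         rel_residual S F n W X Mi l \<mu> / cmod (multiplier W (qnm F n Mi l \<mu>)))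
      + 10 * Cstar / (shift_step W * (real n + 1 / 2)) *
        (rel_residual S F n W X Pl l \<mu> / cmod (multiplier W (qnm F n Pl l \<mu>)))"
  proof -
    \<comment> \<open>Residual over modulus is grouped into one quotient, so that the identity below
      can treat it as an atom.\<close>
    have e: "e \<sigma> = 10 / shift_step W *
        (rel_residual S F n W X \<sigma> l \<mu> / cmod (multiplier W (qnm F n \<sigma> l \<mu>)))" for \<sigma>
      by (simp add: e_def)
    \<comment> \<open>The constant 5 sqrt 2 of the bound arises here, as 10 times sqrt 2 / 2, with q
      = sqrt 2 and r = \<open>real l\<close>.\<close>
    have eq: "C * (q / (2 * r) * (10 / D * a + 10 / D * b) + 10 / D * a / m)
        = 5 * q * C / (D * r) * (a + b) + 10 * C / (D * m) * a"
      if "D \<noteq> 0" "r \<noteq> 0" for C q r D a b m :: real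
    proof -
      have "q / (2 * r) * (10 / D * a + 10 / D * b) = 5 * q / (D * r) * (a + b)"
        using that by (simp add: divide_simps)
      then show ?thesis
        by (simp only: distrib_left) (simp add: mult.commute mult.left_commute)
    qed
    have "shift_step W \<noteq> 0" "real l \<noteq> 0"
      using \<open>valid_window W\<close> l by (auto simp: valid_window_def)
    then show ?thesis
      unfolding e by (rule eq)
  qed
  finally show ?thesis .
qed

end
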